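(* Let $K=\begin{bmatrix} 0&1\\1&0\end{bmatrix}$. The set of matrices $$SL(\mathbb{H}^+)=\left\{A\in GL(2,\mathbb{H}) : {}^t\overline{A}KA=K\right\}$$ is a subgroup of $SL(2,\mathbb{H})$ of real dimension $10$. Moreover, $$SL(\mathbb{H}^+)=\left\{\begin{bmatrix} a & b\\ c & d\end{bmatrix} : a,b,c,d\in\mathbb{H},\ \mathrm{Re}(a\overline{c})=0,\ \mathrm{Re}(b\overline{d})=0,\ \overline{b}c+\overline{d}a=1\right\}.$$ The map $$\Psi: SL(\mathbb{H}^+)\to\mathbb{M}(\mathbb{H}^+),\qquad A=\begin{bmatrix} a & b\\ c & d\end{bmatrix}\mapsto L_A,\quad L_A(q)=(aq+b)\cdot(cq+d)^{-1},$$ is a group homomorphism whose kernel is the center of $SL(\mathbb{H}^+)$, that is, the subgroup $\left\{\pm\begin{bmatrix} 1&0\\0&1\end{bmatrix}\right\}$.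
   Context: $\mathbb{H}$ is the skew field of real quaternions and $\mathbb{H}^+=\{q\in\mathbb{H}:\mathrm{Re}(q)>0\}$. For $A=\begin{bmatrix} a & b\\ c & d\end{bmatrix}$ with quaternionic entries, $\det_{\mathbb{H}}(A)=\sqrt{|a|^2|d|^2+|c|^2|b|^2-2\,\mathrm{Re}(c\,\overline{a}\,b\,\overline{d})}$; $GL(2,\mathbb{H})$ is the group of such matrices with $\det_{\mathbb{H}}(A)\ne0$ (equivalently, invertible), and $SL(2,\mathbb{H})=\{A\in GL(2,\mathbb{H}):\det_{\mathbb{H}}(A)=1\}$. ${}^t\overline{A}$ is the conjugate transpose of $A$. $\mathbb{M}(\mathbb{H}^+)$ is the group of Möbius transformations of $\mathbb{H}^+$, i.e. of all maps $q\mapsto(aq+b)(cq+d)^{-1}$ of $\mathbb{H}\cup\{\infty\}$ with $\begin{bmatrix} a & b\\ c & d\end{bmatrix}\in GL(2,\mathbb{H})$ that map $\mathbb{H}^+$ onto itself. *)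

theory Defs
  imports "HOL-Analysis.Analysis" "HOL-Algebra.Coset"
begin

section \<open>Real quaternions\<close>

codatatype quat = Quat (qRe: real) (qI: real) (qJ: real) (qK: real)

lemma quat_eqI [intro?]:
  "\<lbrakk>qRe x = qRe y; qI x = qI y; qJ x = qJ y; qK x = qK y\<rbrakk> \<Longrightarrow> x = y"
  by (rule quat.expand) simp

lemma quat_eq_iff: "x = y \<longleftrightarrow> qRe x = qRe y \<and> qI x = qI y \<and> qJ x = qJ y \<and> qK x = qK y"
  by (auto intro: quat_eqI)

instantiation quat :: ab_group_add
begin

primcorec zero_quat where
  "qRe 0 = 0" | "qI 0 = 0" | "qJ 0 = 0" | "qK 0 = 0"

primcorec plus_quat where
  "qRe (x + y) = qRe x + qRe y"
| "qI (x + y) = qI x + qI y"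
| "qJ (x + y) = qJ x + qJ y"
| "qK (x + y) = qK x + qK y"

primcorec uminus_quat where
  "qRe (- x) = - qRe x"
| "qI (- x) = - qI x"
| "qJ (- x) = - qJ x"
| "qK (- x) = - qK x"

primcorec minus_quat where
  "qRe (x - y) = qRe x - qRe y"
| "qI (x - y) = qI x - qI y"
| "qJ (x - y) = qJ x - qJ y"
| "qK (x - y) = qK x - qK y"

instance
  by standard (simp_all add: quat_eq_iff)

end

instantiation quat :: ring_1
begin

primcorec one_quat where
  "qRe 1 = 1" | "qI 1 = 0" | "qJ 1 = 0" | "qK 1 = 0"

primcorec times_quat where
  "qRe (x * y) = qRe x * qRe y - qI x * qI y - qJ x * qJ y - qK x * qK y"
| "qI (x * y) = qRe x * qI y + qI x * qRe y + qJ x * qK y - qK x * qJ y"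
| "qJ (x * y) = qRe x * qJ y - qI x * qK y + qJ x * qRe y + qK x * qI y"
| "qK (x * y) = qRe x * qK y + qI x * qJ y - qJ x * qI y + qK x * qRe y"

instance
  by standard (simp_all add: quat_eq_iff algebra_simps)

end

instantiation quat :: real_algebra_1
begin

primcorec scaleR_quat where
  "qRe (scaleR r x) = r * qRe x"
| "qI (scaleR r x) = r * qI x"
| "qJ (scaleR r x) = r * qJ x"
| "qK (scaleR r x) = r * qK x"

instance
  by standard (simp_all add: quat_eq_iff algebra_simps)

end

primcorec qcnj :: "quat \<Rightarrow> quat" where
  "qRe (qcnj x) = qRe x"
| "qI (qcnj x) = - qI x"
| "qJ (qcnj x) = - qJ x"
| "qK (qcnj x) = - qK x"

lemma quat_sum_squares_eq_0_iff:
  "(qRe x)\<^sup>2 + (qI x)\<^sup>2 + (qJ x)\<^sup>2 + (qK x)\<^sup>2 = 0 \<longleftrightarrow> x = 0"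
proof
  assume *: "(qRe x)\<^sup>2 + (qI x)\<^sup>2 + (qJ x)\<^sup>2 + (qK x)\<^sup>2 = 0"
  have "(qRe x)\<^sup>2 \<ge> 0" "(qI x)\<^sup>2 \<ge> 0" "(qJ x)\<^sup>2 \<ge> 0" "(qK x)\<^sup>2 \<ge> 0"
    by simp_all
  with * have "(qRe x)\<^sup>2 = 0" "(qI x)\<^sup>2 = 0" "(qJ x)\<^sup>2 = 0" "(qK x)\<^sup>2 = 0"
    by linarith+
  then show "x = 0"
    by (simp add: quat_eq_iff)
qed simp

instantiation quat :: division_ring
begin

definition inverse_quat :: "quat \<Rightarrow> quat" where
  "inverse x = inverse ((qRe x)\<^sup>2 + (qI x)\<^sup>2 + (qJ x)\<^sup>2 + (qK x)\<^sup>2) *\<^sub>R qcnj x"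

definition divide_quat :: "quat \<Rightarrow> quat \<Rightarrow> quat" where
  "x div y = x * inverse y" for x y :: quat

instance
proof
  fix x y :: quat
  let ?n = "(qRe x)\<^sup>2 + (qI x)\<^sup>2 + (qJ x)\<^sup>2 + (qK x)\<^sup>2"
  have l: "qcnj x * x = ?n *\<^sub>R 1" and r: "x * qcnj x = ?n *\<^sub>R 1"
    by (simp_all add: quat_eq_iff power2_eq_square algebra_simps)
  show "inverse x * x = 1" "x * inverse x = 1" if "x \<noteq> 0"
    using that l r by (simp_all add: inverse_quat_def quat_sum_squares_eq_0_iff)
  show "x div y = x * inverse y"
    by (simp add: divide_quat_def)
  show "inverse (0::quat) = 0"
    by (simp add: inverse_quat_def)
qed

end

instance quat :: real_div_algebra ..

instantiation quat :: real_inner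
begin

definition inner_quat :: "quat \<Rightarrow> quat \<Rightarrow> real" where
  "inner x y = qRe x * qRe y + qI x * qI y + qJ x * qJ y + qK x * qK y"

definition norm_quat :: "quat \<Rightarrow> real" where
  "norm x = sqrt ((qRe x)\<^sup>2 + (qI x)\<^sup>2 + (qJ x)\<^sup>2 + (qK x)\<^sup>2)"

definition sgn_quat :: "quat \<Rightarrow> quat" where
  "sgn x = x /\<^sub>R norm x" for x :: quat

definition dist_quat :: "quat \<Rightarrow> quat \<Rightarrow> real" where
  "dist x y = norm (x - y)" for x y :: quat

definition uniformity_quat :: "(quat \<times> quat) filter" where
  "uniformity = (INF e\<in>{0 <..}. principal {(x, y :: quat). dist x y < e})"

definition open_quat :: "quat set \<Rightarrow> bool" where
  "open U \<longleftrightarrow> (\<forall>x\<in>U. eventually (\<lambda>(x', y). x' = x \<longrightarrow> y \<in> U) uniformity)" for U :: "quat set"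

instance
proof
  fix x y z :: quat and r :: real and U :: "quat set"
  show "dist x y = norm (x - y)" by (rule dist_quat_def)
  show "sgn x = x /\<^sub>R norm x" by (rule sgn_quat_def)
  show "uniformity = (INF e\<in>{0 <..}. principal {(x :: quat, y). dist x y < e})"
    by (rule uniformity_quat_def)
  show "open U \<longleftrightarrow> (\<forall>x\<in>U. eventually (\<lambda>(x', y). x' = x \<longrightarrow> y \<in> U) uniformity)"
    by (rule open_quat_def)
  show "inner x y = inner y x" by (simp add: inner_quat_def algebra_simps)
  show "inner (x + y) z = inner x z + inner y z" by (simp add: inner_quat_def algebra_simps)
  show "inner (r *\<^sub>R x) y = r * inner x y" by (simp add: inner_quat_def algebra_simps)
  have eq: "inner x x = (qRe x)\<^sup>2 + (qI x)\<^sup>2 + (qJ x)\<^sup>2 + (qK x)\<^sup>2"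
    by (simp add: inner_quat_def power2_eq_square)
  show "0 \<le> inner x x" by (simp add: eq)
  show "inner x x = 0 \<longleftrightarrow> x = 0" by (simp only: eq quat_sum_squares_eq_0_iff)
  show "norm x = sqrt (inner x x)" by (simp only: eq norm_quat_def)
qed

end

lemma qcnj_mult: "qcnj (x * y) = qcnj y * qcnj x"
  by (simp add: quat_eq_iff algebra_simps)

lemma quat_mult_qcnj: "x * qcnj x = (norm x)\<^sup>2 *\<^sub>R 1"
  by (simp add: quat_eq_iff norm_quat_def power2_eq_square algebra_simps)

instance quat :: real_normed_div_algebra
proof
  fix x y :: quat
  have "(norm (x * y))\<^sup>2 *\<^sub>R (1 :: quat) = x * (y * qcnj y) * qcnj x"
    by (simp only: quat_mult_qcnj [symmetric] qcnj_mult mult.assoc)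
  also have "\<dots> = ((norm y)\<^sup>2 * (norm x)\<^sup>2) *\<^sub>R 1"
    by (simp add: quat_mult_qcnj)
  finally have "(norm (x * y))\<^sup>2 = (norm x * norm y)\<^sup>2"
    by (simp add: quat_eq_iff power_mult_distrib mult.commute)
  then show "norm (x * y) = norm x * norm y"
    by (rule power2_eq_imp_eq) simp_all
qed

instantiation quat :: euclidean_space
begin

definition Basis_quat :: "quat set" where
  "Basis = {Quat 1 0 0 0, Quat 0 1 0 0, Quat 0 0 1 0, Quat 0 0 0 1}"

instance
proof
  show "(Basis :: quat set) \<noteq> {}"
    unfolding Basis_quat_def by (rule insert_not_empty)
  show "finite (Basis :: quat set)"
    unfolding Basis_quat_def by (intro finite.intros)
  show "inner u v = (if u = v then 1 else 0)" if "u \<in> Basis" "v \<in> Basis" for u v :: quat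
    using that unfolding Basis_quat_def
    by (elim insertE emptyE) (simp_all add: inner_quat_def)
  show "(\<forall>u\<in>Basis. inner x u = 0) \<longleftrightarrow> x = 0" for x :: quat
    unfolding Basis_quat_def inner_quat_def
    by (subst quat_eq_iff) simp
qed

end


section \<open>Quaternionic \<open>2 \<times> 2\<close> matrices\<close>

type_synonym qmat = "quat^2^2"

definition mat2 :: "quat \<Rightarrow> quat \<Rightarrow> quat \<Rightarrow> quat \<Rightarrow> qmat" where
  "mat2 a b c d = vector [vector [a, b], vector [c, d]]"

definition conj_transpose :: "qmat \<Rightarrow> qmat" where
  "conj_transpose A = (\<chi> i j. qcnj (A $ j $ i))"

definition det_quat :: "qmat \<Rightarrow> real" where
  "det_quat A =
    (let a = A $ 1 $ 1; b = A $ 1 $ 2; c = A $ 2 $ 1; d = A $ 2 $ 2 in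
      sqrt ((norm a)\<^sup>2 * (norm d)\<^sup>2 + (norm c)\<^sup>2 * (norm b)\<^sup>2
            - 2 * qRe (c * qcnj a * b * qcnj d)))"

definition GL2H :: "qmat set" where
  "GL2H = {A. det_quat A \<noteq> 0}"

definition SL2H :: "qmat set" where
  "SL2H = {A \<in> GL2H. det_quat A = 1}"

definition SL2H_group :: "qmat monoid" where
  "SL2H_group = \<lparr>carrier = SL2H, monoid.mult = (**), one = mat 1\<rparr>"

definition Kmat :: qmat where
  "Kmat = mat2 0 1 1 0"

definition SLHplus :: "qmat set" where
  "SLHplus = {A \<in> GL2H. conj_transpose A ** Kmat ** A = Kmat}"

definition SLHplus_group :: "qmat monoid" where
  "SLHplus_group = SL2H_group\<lparr>carrier := SLHplus\<rparr>"

definition group_center :: "('a, 'b) monoid_scheme \<Rightarrow> 'a set" where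
  "group_center G = {z \<in> carrier G. \<forall>x \<in> carrier G. z \<otimes>\<^bsub>G\<^esub> x = x \<otimes>\<^bsub>G\<^esub> z}"


section \<open>Moebius transformations\<close>

text \<open>
  The set \<open>\<H> \<union> {\<infinity>}\<close> is \<^typ>\<open>quat option\<close>, with \<^const>\<open>None\<close> as the point
  \<open>\<infinity>\<close>. The usual conventions are \<open>w * 0\<inverse> = \<infinity>\<close> for \<open>w \<noteq> 0\<close>,
  and \<open>\<infinity> \<mapsto> a * c\<inverse>\<close> (which is \<open>\<infinity>\<close> if \<open>c = 0\<close>). For a matrix in
  \<^const>\<open>GL2H\<close> the numerator and the denominator never vanish simultaneously.
\<close>

definition moebius_map :: "qmat \<Rightarrow> quat option \<Rightarrow> quat option" where
  "moebius_map A z =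
    (let a = A $ 1 $ 1; b = A $ 1 $ 2; c = A $ 2 $ 1; d = A $ 2 $ 2 in
      case z of
        Some q \<Rightarrow> if c * q + d = 0 then None else Some ((a * q + b) * inverse (c * q + d))
      | None \<Rightarrow> if c = 0 then None else Some (a * inverse c))"

definition Hplus :: "quat set" where
  "Hplus = {q. qRe q > 0}"

definition MHplus :: "(quat option \<Rightarrow> quat option) set" where
  "MHplus = {f. \<exists>A \<in> GL2H. f = moebius_map A \<and> f ` (Some ` Hplus) = Some ` Hplus}"

definition MHplus_group :: "(quat option \<Rightarrow> quat option) monoid" where
  "MHplus_group = \<lparr>carrier = MHplus, monoid.mult = (\<circ>), one = id\<rparr>"


section \<open>Smooth submanifolds of a Euclidean space\<close>

text \<open>
  \<open>Ck_on n f U\<close> says that \<open>f\<close> is of class \<open>C\<^sup>n\<close> on \<open>U\<close>; it is meant for open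
  \<open>U\<close> only, since derivatives are taken at a point of the whole space.
\<close>

primrec Ck_on :: "nat \<Rightarrow> ('a::real_normed_vector \<Rightarrow> 'b::real_normed_vector) \<Rightarrow> 'a set \<Rightarrow> bool"
where
  "Ck_on 0 f U \<longleftrightarrow> continuous_on U f"
| "Ck_on (Suc n) f U \<longleftrightarrow>
     (\<forall>x \<in> U. f differentiable (at x)) \<and>
     (\<forall>v. Ck_on n (\<lambda>x. frechet_derivative f (at x) v) U)"

definition smooth_on :: "'a set \<Rightarrow> ('a::real_normed_vector \<Rightarrow> 'b::real_normed_vector) \<Rightarrow> bool"
where
  "smooth_on U f \<longleftrightarrow> (\<forall>n. Ck_on n f U)"

definition diffeomorphism_on ::
  "'a set \<Rightarrow> 'b set \<Rightarrow> ('a::real_normed_vector \<Rightarrow> 'b::real_normed_vector) \<Rightarrow> bool"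
where
  "diffeomorphism_on U V \<phi> \<longleftrightarrow>
     bij_betw \<phi> U V \<and> smooth_on U \<phi> \<and> smooth_on V (inv_into U \<phi>)"

text \<open>
  Embedded \<open>C\<^sup>\<infinity>\<close> submanifolds of dimension \<open>k\<close>: around each point there is a chart of
  the ambient space that flattens \<open>S\<close> onto a \<open>k\<close>-dimensional linear subspace. The
  dimension is the real one, also for \<open>S\<close> inside a space of quaternionic matrices.
\<close>

definition smooth_submanifold :: "nat \<Rightarrow> 'a::euclidean_space set \<Rightarrow> bool" where
  "smooth_submanifold k S \<longleftrightarrow>
     (\<forall>p \<in> S. \<exists>U V \<phi>. \<exists>L :: 'a set.
        open U \<and> p \<in> U \<and> open V \<and> diffeomorphism_on U V \<phi> \<and>
        subspace L \<and> dim L = k \<and> \<phi> ` (U \<inter> S) = V \<inter> L)"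

end

theory Submission
  imports Defs
begin

text \<open>
  Write \<open>G\<close> for \<^const>\<open>SLHplus\<close>, the matrices with \<open>A\<^sup>* K A = K\<close>.

  Algebra. The function \<open>det_sq = det_quat\<^sup>2\<close> is multiplicative: the Schur complement formula
  \<open>det_sq A = \<bar>c\<bar>\<^sup>2 \<bar>b - a c\<inverse> d\<bar>\<^sup>2\<close> shows how it behaves under elementary row operations, and every
  matrix with \<open>c \<noteq> 0\<close> is a product of elementary and diagonal matrices (\<open>det_sq_mult\<close>). An
  explicit adjugate then shows that \<open>det_sq A \<noteq> 0\<close> is the same as invertibility. Hence
  \<open>SL(2,\<H>)\<close> is a group, and \<open>A\<^sup>* K A = K\<close> alone forces \<open>det_sq A = 1\<close>. Expanding
  \<open>A\<^sup>* K A\<close> entry by entry gives the description of \<open>G\<close> by the entries of \<open>A\<close>.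

  Dimension. The Cayley transform
  \<open>B \<mapsto> (1 - B)(1 + B)\<inverse> = 2 (1 + B)\<inverse> - 1\<close> carries \<open>G\<close>, where
  \<open>1 + B\<close> is invertible, to its Lie algebra \<open>{X. X\<^sup>* K + K X = 0}\<close> (\<open>Cayley_SLHplus_iff\<close>).
  That space consists of the matrices with entries \<open>a, b, c, - a\<^sup>*\<close> where \<open>b, c\<close> are purely
  imaginary, so its dimension is \<open>4 + 3 + 3 = 10\<close>. Applied to \<open>B = p\<inverse> A\<close> the transform is a chart
  around \<open>p\<close>, and its inverse is of the same form. Both are smooth since matrix inversion is the
  quotient of polynomial maps \<open>qadj A / det_sq A\<close>.

  Moebius maps. In homogeneous coordinates on the projective line over \<open>\<H>\<close> (vectors up to right
  multiplication by scalars) the map \<open>L\<^sub>A\<close> is multiplication by \<open>A\<close>, so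
  \<open>L\<^sub>A\<^sub>B = L\<^sub>A \<circ> L\<^sub>B\<close> follows from associativity (\<open>moebius_map_mult\<close>). On the
  vector \<open>(x, y)\<close> the Hermitian form of \<open>K\<close> takes the value \<open>2 Re (x\<^sup>* y)\<close>, so preserving it means
  preserving the half space (\<open>moebius_map_Hplus\<close>). A matrix acts trivially only if it is a real
  multiple of the identity, and such a matrix lies in \<open>G\<close> only if it is \<open>\<plusminus> 1\<close>; commuting with
  a few diagonal matrices and with \<open>K\<close> leads to the same scalars.
\<close>

section \<open>Calculus of \<open>C\<^sup>n\<close> maps\<close>

lemma Ck_on_has_derivative:
  "\<lbrakk>Ck_on (Suc n) f U; x \<in> U\<rbrakk> \<Longrightarrow> (f has_derivative frechet_derivative f (at x)) (at x)"
  by (simp add: frechet_derivative_works[symmetric])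

text \<open>
  Openness of the domain matters: derivatives are taken in the whole space, so they see a
  neighbourhood of each point and agree for functions that agree on an open set.
\<close>

lemma Ck_on_cong:
  assumes "open U" "\<And>x. x \<in> U \<Longrightarrow> f x = g x" "Ck_on n f U"
  shows "Ck_on n g U"
  using assms(2,3)
proof (induction n arbitrary: f g)
  case 0
  then show ?case by (auto cong: continuous_on_cong)
next
  case (Suc n)
  have der: "(g has_derivative frechet_derivative f (at x)) (at x)" if "x \<in> U" for x
    using Suc.prems that
    by (intro has_derivative_transform_within_open[OF Ck_on_has_derivative \<open>open U\<close>]) auto
  have "Ck_on n (\<lambda>x. frechet_derivative g (at x) v) U" for v
    by (rule Suc.IH[of "\<lambda>x. frechet_derivative f (at x) v"])
      (use Suc.prems frechet_derivative_at[OF der] in auto)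
  with der show ?case by (auto simp: differentiable_def)
qed

text \<open>
  Lets one work with a derivative given by the differentiation rules instead of
  \<^const>\<open>frechet_derivative\<close>.
\<close>

lemma Ck_on_SucI:
  assumes "open U"
    and "\<And>x. x \<in> U \<Longrightarrow> (f has_derivative f' x) (at x)"
    and "\<And>v. Ck_on n (\<lambda>x. f' x v) U"
  shows "Ck_on (Suc n) f U"
proof -
  have "Ck_on n (\<lambda>x. frechet_derivative f (at x) v) U" for v
    by (rule Ck_on_cong[OF \<open>open U\<close> _ assms(3)[of v]])
      (simp add: frechet_derivative_at[OF assms(2), symmetric])
  with assms(2) show ?thesis by (auto simp: differentiable_def)
qed

lemma Ck_on_SucD: "Ck_on (Suc n) f U \<Longrightarrow> Ck_on n f U"
proof (induction n arbitrary: f)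
  case 0
  then show ?case
    by (auto intro!: continuous_at_imp_continuous_on differentiable_imp_continuous_within)
qed auto

lemma Ck_on_const: "Ck_on n (\<lambda>x. c) U"
  by (induction n arbitrary: c) (auto simp: frechet_derivative_const)

lemma Ck_on_ident: "Ck_on n (\<lambda>x. x) U"
  by (cases n) (auto simp: frechet_derivative_ident Ck_on_const)

lemma Ck_on_add:
  assumes "open U" "Ck_on n f U" "Ck_on n g U"
  shows "Ck_on n (\<lambda>x. f x + g x) U"
  using assms(2,3)
proof (induction n arbitrary: f g)
  case 0
  then show ?case by (auto intro: continuous_intros)
next
  case (Suc n)
  show ?case
    by (rule Ck_on_SucI[OF \<open>open U\<close>],
        rule has_derivative_add[OF Ck_on_has_derivative[OF Suc.prems(1)]
                                   Ck_on_has_derivative[OF Suc.prems(2)]])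
      (use Suc in auto)
qed

lemma Ck_on_bounded_linear:
  assumes "open U" "bounded_linear h" "Ck_on n f U"
  shows "Ck_on n (\<lambda>x. h (f x)) U"
  using assms(3)
proof (induction n arbitrary: f)
  case 0
  then show ?case by (auto intro: bounded_linear.continuous_on[OF assms(2)])
next
  case (Suc n)
  show ?case
    by (rule Ck_on_SucI[OF \<open>open U\<close>],
        rule bounded_linear.has_derivative[OF assms(2) Ck_on_has_derivative[OF Suc.prems]])
      (use Suc in auto)
qed

lemma Ck_on_minus:
  assumes U: "open U" and "Ck_on n f U" "Ck_on n g U"
  shows "Ck_on n (\<lambda>x. f x - g x) U"
  using Ck_on_add[OF U assms(2) Ck_on_bounded_linear[OF U bounded_linear_minus[OF bounded_linear_ident]
      assms(3)]]
  by simp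

text \<open>
  By the product rule the derivative is a sum of two products in which one factor has been replaced
  by its derivative; this is why the induction must be over arbitrary \<open>f\<close> and \<open>g\<close>.
\<close>

lemma Ck_on_bounded_bilinear:
  assumes "open U" "bounded_bilinear b" "Ck_on n f U" "Ck_on n g U"
  shows "Ck_on n (\<lambda>x. b (f x) (g x)) U"
  using assms(3,4)
proof (induction n arbitrary: f g)
  case 0
  then show ?case by (auto intro: bounded_bilinear.continuous_on[OF assms(2)])
next
  case (Suc n)
  note f = Suc.prems(1) and g = Suc.prems(2)
  have "Ck_on n (\<lambda>x. b (f x) (frechet_derivative g (at x) v)) U"
    "Ck_on n (\<lambda>x. b (frechet_derivative f (at x) v) (g x)) U" for v
    using f g Ck_on_SucD[OF f] Ck_on_SucD[OF g] by (auto intro!: Suc.IH)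
  then show ?case
    by (intro Ck_on_SucI[OF \<open>open U\<close> bounded_bilinear.FDERIV[OF assms(2)
          Ck_on_has_derivative[OF f] Ck_on_has_derivative[OF g]]]
        Ck_on_add \<open>open U\<close>)
qed

text \<open>
  The derivative \<open>- f' / f\<^sup>2\<close> is a product that contains \<open>1 / f\<close> itself, so the
  induction hypothesis for \<open>1 / f\<close> raises its own class by one.
\<close>

lemma Ck_on_inverse_real:
  fixes f :: "'a::real_normed_vector \<Rightarrow> real"
  assumes "open U" "\<And>x. x \<in> U \<Longrightarrow> f x \<noteq> 0" "Ck_on n f U"
  shows "Ck_on n (\<lambda>x. inverse (f x)) U"
  using assms(3)
proof (induction n)
  case 0
  then show ?case using assms(2) by (auto intro: continuous_intros)
next
  case (Suc n)
  have inv: "Ck_on n (\<lambda>x. inverse (f x)) U"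
    by (rule Suc.IH[OF Ck_on_SucD[OF Suc.prems]])
  note mult = Ck_on_bounded_bilinear[OF \<open>open U\<close> bounded_bilinear_mult]
  have "Ck_on n (\<lambda>x. frechet_derivative f (at x) v) U" for v
    using Suc.prems by simp
  then have "Ck_on n (\<lambda>x. - (inverse (f x) * frechet_derivative f (at x) v * inverse (f x))) U" for v
    by (rule Ck_on_bounded_linear[OF \<open>open U\<close> bounded_linear_minus[OF bounded_linear_ident]
          mult[OF mult[OF inv] inv]])
  moreover have "((\<lambda>x. inverse (f x)) has_derivative
      (\<lambda>v. - (inverse (f x) * frechet_derivative f (at x) v * inverse (f x)))) (at x)" if "x \<in> U" for x
    by (rule Deriv.has_derivative_inverse[OF assms(2) Ck_on_has_derivative[OF Suc.prems]]) fact+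
  ultimately show ?case
    by (intro Ck_on_SucI[OF \<open>open U\<close>])
qed

section \<open>Quaternionic arithmetic\<close>

text \<open>
  The real part is a trace: products may be permuted cyclically under it, which replaces
  commutativity in all the computations below.
\<close>

lemma qRe_mult_commute: "qRe (x * y) = qRe (y * x)"
  by simp

lemma qcnj_qcnj [simp]: "qcnj (qcnj x) = x"
  by (simp add: quat_eq_iff)

lemma qcnj_simps [simp]:
  "qcnj 0 = 0" "qcnj 1 = 1" "qcnj (x + y) = qcnj x + qcnj y" "qcnj (- x) = - qcnj x"
  "qcnj (r *\<^sub>R x) = r *\<^sub>R qcnj x" "qcnj (x - y) = qcnj x - qcnj y"
  by (simp_all add: quat_eq_iff)

lemma norm_qcnj [simp]: "norm (qcnj x) = norm x"
  by (simp add: norm_quat_def)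

lemma qcnj_mult_self: "qcnj x * x = (norm x)\<^sup>2 *\<^sub>R 1"
  using quat_mult_qcnj[of "qcnj x"] by simp

lemma inner_eq_qRe: "inner x y = qRe (x * qcnj y)"
  by (simp add: inner_quat_def)

lemma inverse_eq_qcnj: "inverse x = inverse ((norm x)\<^sup>2) *\<^sub>R qcnj x"
  by (simp add: inverse_quat_def norm_quat_def)

lemma add_qcnj: "x + qcnj x = (2 * qRe x) *\<^sub>R 1"
  by (simp add: quat_eq_iff)

lemma qRe_mult_qcnj_commute: "qRe (x * qcnj y) = qRe (y * qcnj x)"
  by simp

lemma qRe_qcnj_mult: "qRe (qcnj x * y) = qRe (x * qcnj y)"
  by simp

lemma bounded_linear_qRe: "bounded_linear qRe"
  by (simp add: linear_iff linear_conv_bounded_linear[symmetric])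

lemma bounded_linear_qcnj: "bounded_linear qcnj"
  by (simp add: linear_iff linear_conv_bounded_linear[symmetric])

text \<open>
  From here on products stay unexpanded; in real coordinates the identities below would have
  hundreds of monomials.
\<close>

declare times_quat.sel [simp del]

section \<open>Algebra of quaternionic \<open>2 \<times> 2\<close> matrices\<close>

lemma mat2_nth [simp]:
  "mat2 a b c d $ 1 $ 1 = a" "mat2 a b c d $ 1 $ 2 = b"
  "mat2 a b c d $ 2 $ 1 = c" "mat2 a b c d $ 2 $ 2 = d"
  by (simp_all add: mat2_def)

lemma qmat_eq_iff:
  "A = B \<longleftrightarrow> A $ 1 $ 1 = B $ 1 $ 1 \<and> A $ 1 $ 2 = B $ 1 $ 2 \<and> A $ 2 $ 1 = B $ 2 $ 1 \<and>
    A $ 2 $ 2 = B $ 2 $ 2" for A B :: qmat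
  by (auto simp: vec_eq_iff forall_2)

lemma mat2_eq_iff [simp]:
  "mat2 a b c d = mat2 a' b' c' d' \<longleftrightarrow> a = a' \<and> b = b' \<and> c = c' \<and> d = d'"
  by (simp add: qmat_eq_iff)

lemma mat2_cases:
  obtains a b c d where "A = mat2 a b c d"
proof
  show "A = mat2 (A $ 1 $ 1) (A $ 1 $ 2) (A $ 2 $ 1) (A $ 2 $ 2)"
    by (simp add: qmat_eq_iff)
qed

lemma mat2_mult:
  "mat2 a b c d ** mat2 a' b' c' d' =
    mat2 (a * a' + b * c') (a * b' + b * d') (c * a' + d * c') (c * b' + d * d')"
  by (simp add: qmat_eq_iff matrix_matrix_mult_def sum_2)

lemma mat2_algebra:
  "mat2 a b c d + mat2 a' b' c' d' = mat2 (a + a') (b + b') (c + c') (d + d')"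
  "mat2 a b c d - mat2 a' b' c' d' = mat2 (a - a') (b - b') (c - c') (d - d')"
  "- mat2 a b c d = mat2 (- a) (- b) (- c) (- d)"
  "r *\<^sub>R mat2 a b c d = mat2 (r *\<^sub>R a) (r *\<^sub>R b) (r *\<^sub>R c) (r *\<^sub>R d)"
  by (simp_all add: qmat_eq_iff)

lemma mat_1_eq_mat2: "mat 1 = mat2 1 0 0 1"
  by (simp add: qmat_eq_iff mat_def)

lemma zero_eq_mat2: "0 = mat2 0 0 0 0"
  by (simp add: qmat_eq_iff)

lemma conj_transpose_mat2: "conj_transpose (mat2 a b c d) = mat2 (qcnj a) (qcnj c) (qcnj b) (qcnj d)"
  by (simp add: qmat_eq_iff conj_transpose_def)

lemma conj_transpose_mult: "conj_transpose (A ** B) = conj_transpose B ** conj_transpose A"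
  by (cases A rule: mat2_cases, cases B rule: mat2_cases)
    (simp add: mat2_mult conj_transpose_mat2 qcnj_mult)

lemma conj_transpose_simps [simp]:
  "conj_transpose (A + B) = conj_transpose A + conj_transpose B"
  "conj_transpose (A - B) = conj_transpose A - conj_transpose B"
  "conj_transpose (r *\<^sub>R A) = r *\<^sub>R conj_transpose A"
  "conj_transpose (mat 1) = mat 1"
  by (cases A rule: mat2_cases, cases B rule: mat2_cases,
     simp add: mat2_algebra conj_transpose_mat2 mat_1_eq_mat2)+

lemma qmat_mult_algebra:
  fixes A B C :: qmat
  shows "(A + B) ** C = A ** C + B ** C" "A ** (B + C) = A ** B + A ** C"
    "(A - B) ** C = A ** C - B ** C" "A ** (B - C) = A ** B - A ** C"
    "(r *\<^sub>R A) ** C = r *\<^sub>R (A ** C)" "A ** (r *\<^sub>R C) = r *\<^sub>R (A ** C)"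
  by (cases A rule: mat2_cases, cases B rule: mat2_cases, cases C rule: mat2_cases,
      simp add: mat2_algebra mat2_mult algebra_simps)+

lemma bounded_bilinear_qmat_mult: "bounded_bilinear ((**) :: qmat \<Rightarrow> qmat \<Rightarrow> qmat)"
  unfolding bilinear_conv_bounded_bilinear[symmetric] bilinear_def linear_iff
  by (simp add: qmat_mult_algebra)

section \<open>The determinant and invertibility\<close>

text \<open>
  The square of \<^const>\<open>det_quat\<close> is the reduced norm of the matrix algebra. Unlike
  \<^const>\<open>det_quat\<close> it is a polynomial in the real coordinates, hence smooth everywhere.
\<close>

definition det_sq :: "qmat \<Rightarrow> real" where
  "det_sq A = (norm (A $ 1 $ 1))\<^sup>2 * (norm (A $ 2 $ 2))\<^sup>2 + (norm (A $ 2 $ 1))\<^sup>2 * (norm (A $ 1 $ 2))\<^sup>2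
    - 2 * qRe (A $ 2 $ 1 * qcnj (A $ 1 $ 1) * A $ 1 $ 2 * qcnj (A $ 2 $ 2))"

lemma det_quat_eq_sqrt: "det_quat A = sqrt (det_sq A)"
  by (simp add: det_quat_def det_sq_def Let_def)

lemma det_sq_mat2:
  "det_sq (mat2 a b c d) = (norm a)\<^sup>2 * (norm d)\<^sup>2 + (norm c)\<^sup>2 * (norm b)\<^sup>2
    - 2 * qRe (c * qcnj a * b * qcnj d)"
  by (simp add: det_sq_def)

text \<open>
  Expanding \<open>\<bar>b - a c\<inverse> d\<bar>\<^sup>2\<close> produces the mixed term
  \<open>Re (b d\<^sup>* c a\<^sup>*) / \<bar>c\<bar>\<^sup>2\<close>, which is the one in the definition up to a cyclic permutation.
\<close>

lemma det_sq_Schur: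
  assumes "c \<noteq> 0"
  shows "det_sq (mat2 a b c d) = (norm c)\<^sup>2 * (norm (b - a * inverse c * d))\<^sup>2"
proof -
  let ?y = "a * inverse c * d"
  have "(norm c)\<^sup>2 * inner b ?y = (norm c)\<^sup>2 * qRe (b * qcnj d * qcnj (inverse c) * qcnj a)"
    by (simp only: inner_eq_qRe qcnj_mult mult.assoc)
  also have "\<dots> = qRe ((b * qcnj d) * (c * qcnj a))"
    using assms by (simp add: inverse_eq_qcnj mult.assoc)
  also have "\<dots> = qRe (c * qcnj a * b * qcnj d)"
    by (subst qRe_mult_commute) (simp only: mult.assoc)
  finally have *: "(norm c)\<^sup>2 * inner b ?y = qRe (c * qcnj a * b * qcnj d)" .
  have "(norm (b - ?y))\<^sup>2 = (norm b)\<^sup>2 + (norm ?y)\<^sup>2 - 2 * inner b ?y"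
    by (simp add: power2_norm_eq_inner inner_diff inner_commute)
  then have "(norm c)\<^sup>2 * (norm (b - ?y))\<^sup>2 =
      (norm c)\<^sup>2 * (norm b)\<^sup>2 + (norm c)\<^sup>2 * (norm ?y)\<^sup>2 - 2 * ((norm c)\<^sup>2 * inner b ?y)"
    by (simp add: ring_distribs)
  also have "(norm c)\<^sup>2 * (norm ?y)\<^sup>2 = (norm a)\<^sup>2 * (norm d)\<^sup>2"
    using assms by (simp add: norm_mult norm_inverse power_mult_distrib power_inverse)
  finally show ?thesis unfolding * by (simp add: det_sq_mat2)
qed

text \<open>
  Adding a left multiple of the second row to the first one does not change the Schur complement
  \<open>b - a c\<inverse> d\<close>. If \<open>c = 0\<close>, only \<open>\<bar>a\<bar>\<^sup>2 \<bar>d\<bar>\<^sup>2\<close> is left, which the operation does not touch.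
\<close>

lemma det_sq_shear: "det_sq (mat2 1 x 0 1 ** B) = det_sq B"
proof (cases B rule: mat2_cases)
  case (1 a b c d)
  show ?thesis
  proof (cases "c = 0")
    case True
    then show ?thesis by (simp add: 1 mat2_mult det_sq_mat2)
  next
    case False
    have "b + x * d - (a + x * c) * inverse c * d = b - a * inverse c * d"
      using False by (simp add: algebra_simps)
    then show ?thesis
      by (simp only: 1 mat2_mult det_sq_Schur[OF False] mult_1_left mult_zero_left add_0_left)
  qed
qed

lemma det_sq_swap: "det_sq (mat2 0 1 1 0 ** B) = det_sq B"
proof (cases B rule: mat2_cases)
  case (1 a b c d)
  have "qRe (a * qcnj c * d * qcnj b) = qRe (qcnj (a * qcnj c * d * qcnj b))"
    by simp
  also have "\<dots> = qRe ((b * qcnj d) * (c * qcnj a))"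
    by (simp only: qcnj_mult qcnj_qcnj mult.assoc)
  also have "\<dots> = qRe (c * qcnj a * b * qcnj d)"
    by (subst qRe_mult_commute) (simp only: mult.assoc)
  finally show ?thesis by (simp add: 1 mat2_mult det_sq_mat2)
qed

lemma det_sq_diag: "det_sq (mat2 x 0 0 y ** B) = (norm x)\<^sup>2 * (norm y)\<^sup>2 * det_sq B"
proof (cases B rule: mat2_cases)
  case (1 a b c d)
  have "(y * c) * qcnj (x * a) * (x * b) * qcnj (y * d)
      = y * (c * qcnj a * (qcnj x * x) * b * qcnj d * qcnj y)"
    by (simp only: qcnj_mult mult.assoc)
  then have "qRe ((y * c) * qcnj (x * a) * (x * b) * qcnj (y * d))
      = qRe (c * qcnj a * (qcnj x * x) * b * qcnj d * (qcnj y * y))"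
    by (metis qRe_mult_commute mult.assoc)
  also have "\<dots> = (norm x)\<^sup>2 * (norm y)\<^sup>2 * qRe (c * qcnj a * b * qcnj d)"
    by (simp add: qcnj_mult_self mult.assoc)
  finally show ?thesis
    by (simp add: 1 mat2_mult det_sq_mat2 norm_mult power_mult_distrib algebra_simps)
qed

text \<open>
  It suffices to factor \<open>A\<close> into shears, the row swap and diagonal matrices, for which the claim
  is known whatever \<open>B\<close> is. This works if \<open>a\<close> or \<open>c\<close> is nonzero. If the first column of \<open>A\<close>
  vanishes, both rows of \<open>A B\<close> are left multiples of one row and both sides are zero.
\<close>

lemma det_sq_mult: "det_sq (A ** B) = det_sq A * det_sq B"
proof (cases A rule: mat2_cases)
  case (1 a b c d)
  show ?thesis
  proof (cases "c = 0")
    case False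
    let ?s = "b - a * inverse c * d"
    have "c * (inverse c * d) = d"
      using False by (simp add: mult.assoc[symmetric])
    then have "A = mat2 1 (a * inverse c) 0 1 **
        (mat2 0 1 1 0 ** (mat2 c 0 0 ?s ** mat2 1 (inverse c * d) 0 1))"
      using False by (simp add: 1 mat2_mult algebra_simps)
    then have "A ** B = mat2 1 (a * inverse c) 0 1 **
        (mat2 0 1 1 0 ** (mat2 c 0 0 ?s ** (mat2 1 (inverse c * d) 0 1 ** B)))"
      by (simp only: matrix_mul_assoc)
    then have "det_sq (A ** B) = (norm c)\<^sup>2 * (norm ?s)\<^sup>2 * det_sq B"
      by (simp only: det_sq_shear det_sq_swap det_sq_diag)
    then show ?thesis
      by (simp only: 1 det_sq_Schur[OF False])
  next
    case True
    show ?thesis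
    proof (cases "a = 0")
      case False
      have "a * (inverse a * b) = b"
        using False by (simp add: mult.assoc[symmetric])
      then have "A = mat2 a 0 0 d ** mat2 1 (inverse a * b) 0 1"
        using True by (simp add: 1 mat2_mult)
      then have "A ** B = mat2 a 0 0 d ** (mat2 1 (inverse a * b) 0 1 ** B)"
        by (simp only: matrix_mul_assoc)
      then have "det_sq (A ** B) = (norm a)\<^sup>2 * (norm d)\<^sup>2 * det_sq B"
        by (simp only: det_sq_shear det_sq_diag)
      then show ?thesis
        using True 1 by (simp add: det_sq_mat2)
    next
      case a: True
      obtain x y z w where B: "B = mat2 x y z w" by (rule mat2_cases)
      have "A ** B = mat2 b 0 0 d ** mat2 z w z w"
        by (simp add: 1 B True a mat2_mult)
      moreover have "det_sq (mat2 z w z w) = 0"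
      proof (cases "z = 0")
        case False
        then have "w - z * inverse z * w = 0" by simp
        then show ?thesis unfolding det_sq_Schur[OF False] by simp
      qed (simp add: det_sq_mat2)
      ultimately show ?thesis
        by (simp add: 1 True a det_sq_diag det_sq_mat2)
    qed
  qed
qed

lemma det_sq_1 [simp]: "det_sq (mat 1) = 1"
  by (simp add: mat_1_eq_mat2 det_sq_mat2)

text \<open>
  The exponent is \<open>4\<close> because \<open>det_sq\<close> is homogeneous of degree four in the entries.
\<close>

lemma det_sq_scaleR: "det_sq (r *\<^sub>R A) = r ^ 4 * det_sq A"
proof -
  have "r *\<^sub>R A = mat2 (of_real r) 0 0 (of_real r) ** A"
    by (cases A rule: mat2_cases) (simp add: mat2_mult mat2_algebra scaleR_conv_of_real[symmetric])
  then show ?thesis by (simp add: det_sq_diag power4_eq_xxxx power2_eq_square)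
qed

text \<open>
  The quaternionic adjugate. Its entries are polynomial in the real coordinates, which makes
  the inverse \<open>qadj A / det_sq A\<close> visibly smooth.
\<close>

definition qadj :: "qmat \<Rightarrow> qmat" where
  "qadj A = (let a = A $ 1 $ 1; b = A $ 1 $ 2; c = A $ 2 $ 1; d = A $ 2 $ 2 in
    mat2 ((norm d)\<^sup>2 *\<^sub>R qcnj a - qcnj c * d * qcnj b) ((norm b)\<^sup>2 *\<^sub>R qcnj c - qcnj a * b * qcnj d)
         ((norm c)\<^sup>2 *\<^sub>R qcnj b - qcnj d * c * qcnj a) ((norm a)\<^sup>2 *\<^sub>R qcnj d - qcnj b * a * qcnj c))"

lemma qadj_mult: "qadj A ** A = det_sq A *\<^sub>R mat 1"
proof (cases A rule: mat2_cases)
  case (1 a b c d)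
  have trace1: "qcnj a * (b * (qcnj d * c)) + qcnj c * (d * (qcnj b * a)) =
      (2 * qRe (c * qcnj a * b * qcnj d)) *\<^sub>R 1"
  proof -
    have "qcnj c * (d * (qcnj b * a)) = qcnj (qcnj a * (b * (qcnj d * c)))"
      by (simp only: qcnj_mult qcnj_qcnj mult.assoc)
    moreover have "qRe (qcnj a * (b * (qcnj d * c))) = qRe (c * qcnj a * b * qcnj d)"
      by (metis qRe_mult_commute mult.assoc)
    ultimately show ?thesis by (simp only: add_qcnj)
  qed
  have trace2: "qcnj b * (a * (qcnj c * d)) + qcnj d * (c * (qcnj a * b)) =
      (2 * qRe (c * qcnj a * b * qcnj d)) *\<^sub>R 1"
  proof -
    have "qcnj b * (a * (qcnj c * d)) = qcnj (qcnj d * (c * (qcnj a * b)))"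
      by (simp only: qcnj_mult qcnj_qcnj mult.assoc)
    moreover have "qRe (qcnj d * (c * (qcnj a * b))) = qRe (c * qcnj a * b * qcnj d)"
      by (metis qRe_mult_commute mult.assoc)
    ultimately show ?thesis by (metis add_qcnj add.commute)
  qed
  let ?D = "det_sq (mat2 a b c d)"
  have e11: "((norm d)\<^sup>2 *\<^sub>R qcnj a - qcnj c * d * qcnj b) * a +
      ((norm b)\<^sup>2 *\<^sub>R qcnj c - qcnj a * b * qcnj d) * c = ?D *\<^sub>R 1" (is "?l = _")
  proof -
    \<comment> \<open>The two mixed products are conjugate, so their sum is real.\<close>
    have "?l = (norm d)\<^sup>2 *\<^sub>R (qcnj a * a) + (norm b)\<^sup>2 *\<^sub>R (qcnj c * c) -
        (qcnj a * (b * (qcnj d * c)) + qcnj c * (d * (qcnj b * a)))"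
      by (simp add: left_diff_distrib mult.assoc)
    then show ?thesis
      unfolding trace1 qcnj_mult_self by (simp add: det_sq_mat2 scaleR_left_distrib
          scaleR_left_diff_distrib mult.commute)
  qed
  have e22: "((norm c)\<^sup>2 *\<^sub>R qcnj b - qcnj d * c * qcnj a) * b +
      ((norm a)\<^sup>2 *\<^sub>R qcnj d - qcnj b * a * qcnj c) * d = ?D *\<^sub>R 1" (is "?l = _")
  proof -
    have "?l = (norm c)\<^sup>2 *\<^sub>R (qcnj b * b) + (norm a)\<^sup>2 *\<^sub>R (qcnj d * d) -
        (qcnj b * (a * (qcnj c * d)) + qcnj d * (c * (qcnj a * b)))"
      by (simp add: left_diff_distrib mult.assoc)
    then show ?thesis
      unfolding trace2 qcnj_mult_self by (simp add: det_sq_mat2 scaleR_left_distrib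
          scaleR_left_diff_distrib mult.commute)
  qed
  show ?thesis
    using e11 e22
    by (simp add: 1 qadj_def mat2_mult mat_1_eq_mat2 mat2_algebra
        left_diff_distrib mult.assoc qcnj_mult_self)
qed

lemma left_inverse_qmat:
  assumes "det_sq A \<noteq> 0"
  shows "(inverse (det_sq A) *\<^sub>R qadj A) ** A = mat 1"
  using assms by (simp add: qmat_mult_algebra qadj_mult)

text \<open>
  The adjugate provides a left inverse \<open>X\<close>. It is a right inverse as well, because
  \<open>det_sq X \<noteq> 0\<close> by multiplicativity, so \<open>X\<close> has a left inverse in turn, which must be \<open>A\<close>.
\<close>

lemma invertible_qmat_iff: "invertible A \<longleftrightarrow> det_sq A \<noteq> 0" for A :: qmat
proof
  assume "invertible A"
  then obtain A' where "A ** A' = mat 1" by (auto simp: invertible_def)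
  from arg_cong[OF this, of det_sq] show "det_sq A \<noteq> 0" by (auto simp: det_sq_mult)
next
  assume A: "det_sq A \<noteq> 0"
  define X where "X = inverse (det_sq A) *\<^sub>R qadj A"
  have XA: "X ** A = mat 1"
    unfolding X_def by (rule left_inverse_qmat[OF A])
  have "det_sq X \<noteq> 0"
    using arg_cong[OF XA, of det_sq] by (auto simp: det_sq_mult)
  from left_inverse_qmat[OF this] obtain Y where YX: "Y ** X = mat 1" by blast
  have "Y = A"
    by (metis XA YX matrix_mul_assoc matrix_mul_lid matrix_mul_rid)
  with XA YX show "invertible A" by (auto simp: invertible_def)
qed

lemma GL2H_iff: "A \<in> GL2H \<longleftrightarrow> invertible A"
  by (simp add: GL2H_def det_quat_eq_sqrt invertible_qmat_iff)

lemma SL2H_iff: "A \<in> SL2H \<longleftrightarrow> det_sq A = 1"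
  by (auto simp: SL2H_def GL2H_def det_quat_eq_sqrt)

lemma matrix_inv_qmat:
  assumes "invertible A"
  shows "A ** matrix_inv A = mat 1" "matrix_inv A ** A = mat 1"
proof -
  have "A ** matrix_inv A = mat 1 \<and> matrix_inv A ** A = mat 1"
    unfolding matrix_inv_def by (rule someI_ex) (use assms in \<open>simp add: invertible_def\<close>)
  then show "A ** matrix_inv A = mat 1" "matrix_inv A ** A = mat 1" by blast+
qed

lemma matrix_inv_unique_qmat:
  fixes A B :: qmat
  assumes "A ** B = mat 1" "invertible A"
  shows "matrix_inv A = B"
proof -
  have "B = (matrix_inv A ** A) ** B"
    by (simp only: matrix_inv_qmat(2)[OF assms(2)] matrix_mul_lid)
  also have "\<dots> = matrix_inv A ** (A ** B)"
    by (simp only: matrix_mul_assoc)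
  finally show ?thesis by (simp only: assms(1) matrix_mul_rid)
qed

lemma matrix_inv_eq_qadj:
  assumes "det_sq A \<noteq> 0"
  shows "matrix_inv A = inverse (det_sq A) *\<^sub>R qadj A" (is "_ = ?X")
proof -
  have "matrix_inv A = (?X ** A) ** matrix_inv A"
    by (simp only: left_inverse_qmat[OF assms] matrix_mul_lid)
  also have "\<dots> = ?X ** (A ** matrix_inv A)"
    by (simp only: matrix_mul_assoc)
  finally show ?thesis
    by (simp only: matrix_inv_qmat(1)[OF assms[folded invertible_qmat_iff]] matrix_mul_rid)
qed

lemma invertible_matrix_inv_qmat: "invertible A \<Longrightarrow> invertible (matrix_inv A)" for A :: qmat
  unfolding invertible_def[of "matrix_inv A"] using matrix_inv_qmat by blast

lemma invertible_qmat_mult: "invertible A \<Longrightarrow> invertible B \<Longrightarrow> invertible (A ** B)" for A B :: qmat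
  by (simp add: invertible_qmat_iff det_sq_mult)

section \<open>The unitary group of the form \<open>K\<close>\<close>

lemma group_SL2H: "group SL2H_group"
proof (rule groupI)
  fix A assume "A \<in> carrier SL2H_group"
  then have A: "det_sq A = 1" by (simp add: SL2H_group_def SL2H_iff)
  then have inv: "invertible A" by (simp add: invertible_qmat_iff)
  with A have "det_sq (matrix_inv A) = 1"
    using arg_cong[OF matrix_inv_qmat(1)[OF inv], of det_sq] by (simp add: det_sq_mult)
  then show "\<exists>B\<in>carrier SL2H_group. B \<otimes>\<^bsub>SL2H_group\<^esub> A = \<one>\<^bsub>SL2H_group\<^esub>"
    using matrix_inv_qmat(2)[OF inv] by (auto simp: SL2H_group_def SL2H_iff)
qed (auto simp: SL2H_group_def SL2H_iff det_sq_mult matrix_mul_assoc)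

lemma conj_transpose_Kmat_mult:
  "conj_transpose (mat2 a b c d) ** Kmat ** mat2 a b c d =
    mat2 ((2 * qRe (a * qcnj c)) *\<^sub>R 1) (qcnj (qcnj b * c + qcnj d * a))
      (qcnj b * c + qcnj d * a) ((2 * qRe (b * qcnj d)) *\<^sub>R 1)"
proof -
  have "qcnj c * a + qcnj a * c = (2 * qRe (a * qcnj c)) *\<^sub>R 1" for a c
    using add_qcnj[of "qcnj c * a"] by (simp add: qcnj_mult qRe_qcnj_mult qRe_mult_qcnj_commute[of a])
  then show ?thesis
    by (simp add: Kmat_def conj_transpose_mat2 mat2_mult qcnj_mult add.commute
        qRe_mult_qcnj_commute[of c] qRe_mult_qcnj_commute[of d])
qed

text \<open>
  The conditions on the entries are the entries of the matrix equation; the two off-diagonal ones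
  are conjugate to each other and count once.
\<close>

lemma Kmat_form_iff:
  "conj_transpose (mat2 a b c d) ** Kmat ** mat2 a b c d = Kmat \<longleftrightarrow>
    qRe (a * qcnj c) = 0 \<and> qRe (b * qcnj d) = 0 \<and> qcnj b * c + qcnj d * a = 1"
  unfolding conj_transpose_Kmat_mult by (auto simp: Kmat_def simp del: qcnj_simps(3))

lemma det_sq_Kmat [simp]: "det_sq Kmat = 1"
  by (simp add: Kmat_def det_sq_mat2)

lemma det_sq_conj_transpose: "det_sq (conj_transpose A) = det_sq A"
proof (cases A rule: mat2_cases)
  case (1 a b c d)
  have "qRe (qcnj b * a * qcnj c * d) = qRe (qcnj (qcnj b * a * qcnj c * d))"
    by simp
  also have "\<dots> = qRe (qcnj d * (c * qcnj a * b))"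
    by (simp only: qcnj_mult qcnj_qcnj mult.assoc)
  also have "\<dots> = qRe (c * qcnj a * b * qcnj d)"
    by (rule qRe_mult_commute)
  finally show ?thesis
    by (simp add: 1 conj_transpose_mat2 det_sq_mat2 mult.commute)
qed

lemma det_sq_nonneg: "0 \<le> det_sq A"
proof (cases A rule: mat2_cases)
  case (1 a b c d)
  show ?thesis
  proof (cases "c = 0")
    case False
    then show ?thesis unfolding 1 det_sq_Schur[OF False] by simp
  qed (simp add: 1 det_sq_mat2)
qed

text \<open>
  Taking \<open>det_sq\<close> of \<open>A\<^sup>* K A = K\<close> gives \<open>det_sq A\<^sup>2 = 1\<close>, and
  \<open>det_sq\<close> is nonnegative by the Schur formula.
\<close>

lemma Kmat_form_det:
  assumes "conj_transpose A ** Kmat ** A = Kmat"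
  shows "det_sq A = 1"
proof -
  have "det_sq A ^ 2 = 1"
    using arg_cong[OF assms, of det_sq] by (simp add: det_sq_mult det_sq_conj_transpose power2_eq_square)
  with det_sq_nonneg[of A] show ?thesis by (simp add: power2_eq_1_iff)
qed

lemma SLHplus_iff: "A \<in> SLHplus \<longleftrightarrow> conj_transpose A ** Kmat ** A = Kmat"
  using Kmat_form_det by (auto simp: SLHplus_def GL2H_iff invertible_qmat_iff)

lemma mat2_in_SLHplus_iff: "mat2 a b c d \<in> SLHplus \<longleftrightarrow>
    qRe (a * qcnj c) = 0 \<and> qRe (b * qcnj d) = 0 \<and> qcnj b * c + qcnj d * a = 1"
  by (simp only: SLHplus_iff Kmat_form_iff)

lemma SLHplus_eq: "SLHplus = {mat2 a b c d | a b c d :: quat.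
        qRe (a * qcnj c) = 0 \<and> qRe (b * qcnj d) = 0 \<and> qcnj b * c + qcnj d * a = 1}"
proof (rule Set.set_eqI)
  fix A
  show "A \<in> SLHplus \<longleftrightarrow> A \<in> {mat2 a b c d | a b c d :: quat.
        qRe (a * qcnj c) = 0 \<and> qRe (b * qcnj d) = 0 \<and> qcnj b * c + qcnj d * a = 1}"
    by (cases A rule: mat2_cases) (simp add: mat2_in_SLHplus_iff)
qed

lemma SLHplus_invertible: "A \<in> SLHplus \<Longrightarrow> invertible A"
  by (simp add: SLHplus_def GL2H_iff)

lemma SLHplus_one: "mat 1 \<in> SLHplus"
  by (simp add: SLHplus_iff)

lemma SLHplus_mult:
  assumes "A \<in> SLHplus" "B \<in> SLHplus"
  shows "A ** B \<in> SLHplus"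
proof -
  have "conj_transpose (A ** B) ** Kmat ** (A ** B) =
      conj_transpose B ** (conj_transpose A ** Kmat ** A) ** B"
    by (simp only: conj_transpose_mult matrix_mul_assoc)
  with assms show ?thesis by (simp add: SLHplus_iff)
qed

lemma SLHplus_inv:
  assumes "A \<in> SLHplus"
  shows "matrix_inv A \<in> SLHplus"
proof -
  let ?B = "matrix_inv A"
  have inv: "A ** ?B = mat 1"
    by (rule matrix_inv_qmat[OF SLHplus_invertible[OF assms]])
  then have inv': "conj_transpose ?B ** conj_transpose A = mat 1"
    by (metis conj_transpose_mult conj_transpose_simps(4))
  have "conj_transpose ?B ** Kmat ** ?B = conj_transpose ?B ** (conj_transpose A ** Kmat ** A) ** ?B"
    using assms by (simp add: SLHplus_iff)
  also have "\<dots> = (conj_transpose ?B ** conj_transpose A) ** Kmat ** (A ** ?B)"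
    by (simp only: matrix_mul_assoc)
  finally show ?thesis by (simp add: inv inv' SLHplus_iff)
qed

lemma subgroup_SLHplus: "subgroup SLHplus SL2H_group"
proof (rule group.subgroupI[OF group_SL2H])
  show "SLHplus \<subseteq> carrier SL2H_group"
    by (auto simp: SL2H_group_def SL2H_iff SLHplus_iff Kmat_form_det)
  show "SLHplus \<noteq> {}" using SLHplus_one by blast
  fix A assume A: "A \<in> SLHplus"
  then have "matrix_inv A = inv\<^bsub>SL2H_group\<^esub> A"
    by (intro group.inv_equality[OF group_SL2H, symmetric])
      (use A SLHplus_inv[OF A] SLHplus_invertible in
        \<open>auto simp: SL2H_group_def SL2H_iff SLHplus_iff Kmat_form_det matrix_inv_qmat\<close>)
  with SLHplus_inv[OF A] show "inv\<^bsub>SL2H_group\<^esub> A \<in> SLHplus" by simp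
qed (simp add: SL2H_group_def SLHplus_mult)

lemma group_SLHplus: "group SLHplus_group"
  unfolding SLHplus_group_def
  by (rule subgroup.subgroup_is_group[OF subgroup_SLHplus group_SL2H])

section \<open>Smoothness of matrix inversion\<close>

lemma Ck_on_mat2:
  assumes U: "open U" and "Ck_on n a U" "Ck_on n b U" "Ck_on n c U" "Ck_on n d U"
  shows "Ck_on n (\<lambda>x. mat2 (a x) (b x) (c x) (d x)) U"
proof -
  have "bounded_linear (\<lambda>z. mat2 z 0 0 0)" "bounded_linear (\<lambda>z. mat2 0 z 0 0)"
    "bounded_linear (\<lambda>z. mat2 0 0 z 0)" "bounded_linear (\<lambda>z. mat2 0 0 0 z)"
    by (simp_all add: linear_conv_bounded_linear[symmetric] linear_iff mat2_algebra)
  note lin = this[THEN Ck_on_bounded_linear[OF U]]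
  have "Ck_on n (\<lambda>x. mat2 (a x) 0 0 0 + mat2 0 (b x) 0 0 + mat2 0 0 (c x) 0 + mat2 0 0 0 (d x)) U"
    by (rule Ck_on_add[OF U Ck_on_add[OF U Ck_on_add[OF U lin(1) lin(2)] lin(3)] lin(4)]; fact)
  then show ?thesis by (simp add: mat2_algebra)
qed

lemma bounded_linear_entry: "bounded_linear (\<lambda>A::qmat. A $ i $ j)"
  by (simp add: linear_conv_bounded_linear[symmetric] linear_iff)

lemma
  fixes f :: "'a::real_normed_vector \<Rightarrow> qmat"
  assumes U: "open U" and f: "Ck_on n f U"
  shows Ck_on_det_sq: "Ck_on n (\<lambda>x. det_sq (f x)) U"
    and Ck_on_qadj: "Ck_on n (\<lambda>x. qadj (f x)) U"
proof -
  note entry = Ck_on_bounded_linear[OF U bounded_linear_entry f]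
  note cnj = Ck_on_bounded_linear[OF U bounded_linear_qcnj]
  note mult = Ck_on_bounded_bilinear[OF U bounded_bilinear_mult]
  note scale = Ck_on_bounded_bilinear[OF U bounded_bilinear_scaleR]
  have norm: "Ck_on n (\<lambda>x. (norm (f x $ i $ j))\<^sup>2) U" for i j
    unfolding power2_norm_eq_inner
    by (rule Ck_on_bounded_bilinear[OF U bounded_bilinear_inner entry entry])
  show "Ck_on n (\<lambda>x. det_sq (f x)) U"
    unfolding det_sq_def
    by (intro Ck_on_minus[OF U] Ck_on_add[OF U] mult[OF norm norm] mult[OF Ck_on_const]
        Ck_on_bounded_linear[OF U bounded_linear_qRe] mult[OF mult[OF mult[OF entry cnj[OF entry]] entry]
          cnj[OF entry]])
  show "Ck_on n (\<lambda>x. qadj (f x)) U"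
    unfolding qadj_def Let_def
    by (intro Ck_on_mat2[OF U] Ck_on_minus[OF U] scale[OF norm cnj[OF entry]]
        mult[OF mult[OF cnj[OF entry] entry] cnj[OF entry]])
qed

lemma Ck_on_matrix_inv:
  fixes f :: "'a::real_normed_vector \<Rightarrow> qmat"
  assumes U: "open U" and f: "Ck_on n f U" and inv: "\<And>x. x \<in> U \<Longrightarrow> invertible (f x)"
  shows "Ck_on n (\<lambda>x. matrix_inv (f x)) U"
proof (rule Ck_on_cong[OF U])
  show "inverse (det_sq (f x)) *\<^sub>R qadj (f x) = matrix_inv (f x)" if "x \<in> U" for x
    using inv[OF that] by (simp add: invertible_qmat_iff matrix_inv_eq_qadj)
  have "det_sq (f x) \<noteq> 0" if "x \<in> U" for x
    using inv[OF that] by (simp add: invertible_qmat_iff)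
  then show "Ck_on n (\<lambda>x. inverse (det_sq (f x)) *\<^sub>R qadj (f x)) U"
    by (intro Ck_on_bounded_bilinear[OF U bounded_bilinear_scaleR
          Ck_on_inverse_real[OF U _ Ck_on_det_sq[OF U f]] Ck_on_qadj[OF U f]])
qed

text \<open>
  Stated for a continuous family because the two domains of the Cayley chart are the preimages of
  the invertible matrices under \<open>A \<mapsto> p + A\<close> and \<open>X \<mapsto> 1 + X\<close>.
\<close>

lemma open_invertible_qmat:
  fixes f :: "'a::real_normed_vector \<Rightarrow> qmat"
  assumes "continuous_on UNIV f"
  shows "open {x. invertible (f x)}"
proof -
  have "continuous_on UNIV (\<lambda>x. det_sq (f x))"
    using Ck_on_det_sq[of UNIV 0 f] assms by simp
  then show ?thesis
    unfolding invertible_qmat_iff using open_Collect_neq[of "\<lambda>x. det_sq (f x)" "\<lambda>_. 0"] by simp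
qed

section \<open>The Lie algebra and the Cayley chart\<close>

definition lie_SLHplus :: "qmat set" where
  "lie_SLHplus = {X. conj_transpose X ** Kmat + Kmat ** X = 0}"

lemma mat2_in_lie_SLHplus_iff:
  "mat2 a b c d \<in> lie_SLHplus \<longleftrightarrow> qRe b = 0 \<and> qRe c = 0 \<and> d = - qcnj a"
  by (auto simp: lie_SLHplus_def Kmat_def conj_transpose_mat2 mat2_mult mat2_algebra zero_eq_mat2
      quat_eq_iff)

lemma subspace_lie_SLHplus: "subspace lie_SLHplus"
proof (rule subspaceI)
  show "0 \<in> lie_SLHplus" by (simp add: zero_eq_mat2 mat2_in_lie_SLHplus_iff)
  fix X Y assume "X \<in> lie_SLHplus" "Y \<in> lie_SLHplus"
  then show "X + Y \<in> lie_SLHplus"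
    by (cases X rule: mat2_cases, cases Y rule: mat2_cases)
      (simp add: mat2_algebra mat2_in_lie_SLHplus_iff)
next
  fix X and r :: real assume "X \<in> lie_SLHplus"
  then show "r *\<^sub>R X \<in> lie_SLHplus"
    by (cases X rule: mat2_cases) (simp add: mat2_algebra mat2_in_lie_SLHplus_iff)
qed

lemma dim_lie_SLHplus: "dim lie_SLHplus = 10"
proof -
  define im :: "real^3 \<Rightarrow> quat" where "im v = Quat 0 (v $ 1) (v $ 2) (v $ 3)" for v
  define f :: "quat \<times> (real^3) \<times> (real^3) \<Rightarrow> qmat"
    where "f = (\<lambda>(a, u, v). mat2 a (im u) (im v) (- qcnj a))"
  have im_lin: "im (u + v) = im u + im v" "im (r *\<^sub>R u) = r *\<^sub>R im u" for u v r
    by (simp_all add: im_def quat_eq_iff)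
  have im_inj: "im u = im v \<longleftrightarrow> u = v" for u v
    by (auto simp: im_def vec_eq_iff forall_3)
  have "linear f"
    by (auto simp: linear_iff f_def im_lin mat2_algebra)
  moreover have "inj f"
    by (auto simp: inj_on_def f_def im_inj)
  moreover have "range f = lie_SLHplus"
  proof (intro equalityI subsetI)
    fix X assume "X \<in> range f"
    then show "X \<in> lie_SLHplus" by (auto simp: f_def mat2_in_lie_SLHplus_iff im_def)
  next
    fix X assume X: "X \<in> lie_SLHplus"
    obtain a b c d where mat: "X = mat2 a b c d" by (rule mat2_cases)
    have "X = f (a, vector [qI b, qJ b, qK b], vector [qI c, qJ c, qK c])"
      using X by (simp add: mat f_def im_def mat2_in_lie_SLHplus_iff quat_eq_iff vector_3)
    then show "X \<in> range f" by blast
  qed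
  ultimately have "dim lie_SLHplus = dim (UNIV :: (quat \<times> (real^3) \<times> (real^3)) set)"
    using dim_image_eq[of f UNIV] by (simp add: inj_on_subset)
  also have "\<dots> = DIM(quat) + 6"
    by simp
  also have "DIM(quat) = 4"
    by (simp add: Basis_quat_def)
  finally show ?thesis by simp
qed

text \<open>
  With \<open>M = 1 + B\<close> the hypothesis reads \<open>X M = 1 - B\<close>, that is \<open>X = (1 - B)(1 + B)\<inverse>\<close>.
  The point is the identity \<open>M\<^sup>* (X\<^sup>* K + K X) M = 2 (K - B\<^sup>* K B)\<close>, where \<open>M\<close> is
  invertible.
\<close>

lemma Cayley_SLHplus_iff:
  assumes "(mat 1 + X) ** (mat 1 + B) = 2 *\<^sub>R mat 1"
  shows "X \<in> lie_SLHplus \<longleftrightarrow> B \<in> SLHplus"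
proof -
  define M L where "M = mat 1 + B" and "L = conj_transpose X ** Kmat + Kmat ** X"
  define C where "C = conj_transpose B"
  have M': "conj_transpose M = mat 1 + C"
    by (simp add: M_def C_def)
  \<comment> \<open>\<open>(1 + X) M = 2\<close> has nonzero determinant, hence so has \<open>M\<close>.\<close>
  have inv: "invertible M"
    using arg_cong[OF assms, of det_sq]
    by (auto simp: M_def invertible_qmat_iff det_sq_mult det_sq_scaleR)
  have "M + X ** M = 2 *\<^sub>R mat 1"
    using assms by (simp only: M_def[symmetric] qmat_mult_algebra matrix_mul_lid)
  then have XM: "X ** M = mat 1 - B"
    by (simp add: M_def scaleR_2 algebra_simps)
  have MX: "conj_transpose M ** conj_transpose X = mat 1 - C"
    using arg_cong[OF XM, of conj_transpose] by (simp add: conj_transpose_mult C_def)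
  have "conj_transpose M ** L ** M =
      (conj_transpose M ** conj_transpose X) ** Kmat ** M + conj_transpose M ** Kmat ** (X ** M)"
    by (simp only: L_def qmat_mult_algebra(1,2) matrix_mul_assoc)
  also have "\<dots> = (mat 1 - C) ** Kmat ** (mat 1 + B) + (mat 1 + C) ** Kmat ** (mat 1 - B)"
    unfolding MX XM unfolding M' by (simp only: M_def)
  also have "\<dots> = 2 *\<^sub>R (Kmat - C ** Kmat ** B)"
  proof -
    have "(x - y) + (w - z) + ((x + y) - (w + z)) = 2 *\<^sub>R (x - z)" for x y w z :: qmat
      by (simp add: scaleR_2)
    then show ?thesis
      by (simp only: qmat_mult_algebra(1-4) matrix_mul_lid matrix_mul_rid)
  qed
  finally have key: "conj_transpose M ** L ** M = 2 *\<^sub>R (Kmat - C ** Kmat ** B)" .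
  have z: "A ** 0 = 0" "0 ** A = 0" for A :: qmat
    by (simp_all add: matrix_matrix_mult_def vec_eq_iff)
  have "L = 0 \<longleftrightarrow> conj_transpose M ** L ** M = 0"
  proof
    assume *: "conj_transpose M ** L ** M = 0"
    have "L = conj_transpose (M ** matrix_inv M) ** L ** (M ** matrix_inv M)"
      by (simp add: matrix_inv_qmat[OF inv])
    also have "\<dots> = conj_transpose (matrix_inv M) ** (conj_transpose M ** L ** M) ** matrix_inv M"
      by (simp only: conj_transpose_mult matrix_mul_assoc)
    finally show "L = 0" by (simp only: * z)
  qed (simp add: z)
  also have "\<dots> \<longleftrightarrow> C ** Kmat ** B = Kmat"
    by (auto simp: key)
  finally show ?thesis
    by (simp only: lie_SLHplus_def SLHplus_iff C_def L_def mem_Collect_eq)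
qed

text \<open>
  The chart at \<open>p\<close> is the Cayley transform of \<open>p\<inverse> A\<close>, which simplifies to
  \<open>2 (p + A)\<inverse> p - 1\<close>. It is defined at \<open>A = p\<close> since \<open>2 p\<close> is invertible.
\<close>

lemma smooth_submanifold_SLHplus: "smooth_submanifold 10 SLHplus"
  unfolding smooth_submanifold_def
proof (intro ballI exI conjI)
  fix p assume p: "p \<in> SLHplus"
  define U V where "U = {A. invertible (p + A)}" and "V = {X :: qmat. invertible (mat 1 + X)}"
  define \<phi> where "\<phi> A = 2 *\<^sub>R (matrix_inv (p + A) ** p) - mat 1" for A
  define \<psi> where "\<psi> X = p ** (2 *\<^sub>R matrix_inv (mat 1 + X) - mat 1)" for X
  have inv_p: "invertible p"
    by (rule SLHplus_invertible[OF p])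
  have scale: "invertible (2 *\<^sub>R A)" if "invertible A" for A :: qmat
    using that by (simp add: invertible_qmat_iff det_sq_scaleR)
  show U: "open U" and V: "open V"
    unfolding U_def V_def by (intro open_invertible_qmat continuous_intros)+
  show "p \<in> U"
    using scale[OF inv_p] by (simp add: U_def scaleR_2)
  have phi_plus: "mat 1 + \<phi> A = 2 *\<^sub>R (matrix_inv (p + A) ** p)" for A
    by (simp add: \<phi>_def)
  have psi_plus: "p + \<psi> X = 2 *\<^sub>R (p ** matrix_inv (mat 1 + X))" for X
    by (simp add: \<psi>_def qmat_mult_algebra)
  have phi_V: "\<phi> A \<in> V" if "A \<in> U" for A
    using that unfolding V_def U_def mem_Collect_eq phi_plus
    by (intro scale invertible_qmat_mult invertible_matrix_inv_qmat inv_p)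
  have psi_U: "\<psi> X \<in> U" if "X \<in> V" for X
    using that unfolding V_def U_def mem_Collect_eq psi_plus
    by (intro scale invertible_qmat_mult invertible_matrix_inv_qmat inv_p)
  have psi_phi: "\<psi> (\<phi> A) = A" if "A \<in> U" for A
  proof -
    have inv: "invertible (p + A)" using that by (simp add: U_def)
    have "matrix_inv (p + A) ** (p ** matrix_inv p) ** (p + A) = mat 1"
      by (simp add: matrix_inv_qmat[OF inv_p] matrix_inv_qmat[OF inv])
    then have "(mat 1 + \<phi> A) ** ((1 / 2) *\<^sub>R (matrix_inv p ** (p + A))) = mat 1"
      unfolding phi_plus qmat_mult_algebra(5,6) by (simp add: matrix_mul_assoc)
    then have "matrix_inv (mat 1 + \<phi> A) = (1 / 2) *\<^sub>R (matrix_inv p ** (p + A))"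
      by (rule matrix_inv_unique_qmat) (use phi_V[OF that] in \<open>simp add: V_def\<close>)
    then have "\<psi> (\<phi> A) = p ** (matrix_inv p ** (p + A) - mat 1)"
      by (simp add: \<psi>_def)
    also have "\<dots> = (p ** matrix_inv p) ** (p + A) - p"
      by (simp only: qmat_mult_algebra(4) matrix_mul_assoc matrix_mul_rid)
    finally show ?thesis by (simp add: matrix_inv_qmat[OF inv_p])
  qed
  have phi_psi: "\<phi> (\<psi> X) = X" if "X \<in> V" for X
  proof -
    have inv: "invertible (mat 1 + X)" using that by (simp add: V_def)
    have "p ** (matrix_inv (mat 1 + X) ** (mat 1 + X)) ** matrix_inv p = mat 1"
      by (simp add: matrix_inv_qmat[OF inv_p] matrix_inv_qmat[OF inv])
    then have "(p + \<psi> X) ** ((1 / 2) *\<^sub>R ((mat 1 + X) ** matrix_inv p)) = mat 1"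
      unfolding psi_plus qmat_mult_algebra(5,6) by (simp add: matrix_mul_assoc)
    then have "matrix_inv (p + \<psi> X) = (1 / 2) *\<^sub>R ((mat 1 + X) ** matrix_inv p)"
      by (rule matrix_inv_unique_qmat) (use psi_U[OF that] in \<open>simp add: U_def\<close>)
    then have "\<phi> (\<psi> X) = (mat 1 + X) ** (matrix_inv p ** p) - mat 1"
      by (simp add: \<phi>_def qmat_mult_algebra(5) matrix_mul_assoc)
    then show ?thesis by (simp add: matrix_inv_qmat[OF inv_p])
  qed
  have bij: "bij_betw \<phi> U V"
    by (rule bij_betw_byWitness[where f' = \<psi>]) (use psi_phi phi_psi phi_V psi_U in auto)
  have smooth_phi: "Ck_on n \<phi> U" for n
    unfolding \<phi>_def[abs_def]
    by (intro Ck_on_minus[OF U] Ck_on_const Ck_on_bounded_linear[OF U bounded_linear_scaleR_right]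
        Ck_on_bounded_bilinear[OF U bounded_bilinear_qmat_mult] Ck_on_matrix_inv[OF U]
        Ck_on_add[OF U] Ck_on_ident)
      (simp add: U_def)
  have smooth_psi: "Ck_on n \<psi> V" for n
    unfolding \<psi>_def[abs_def]
    by (intro Ck_on_minus[OF V] Ck_on_const Ck_on_bounded_linear[OF V bounded_linear_scaleR_right]
        Ck_on_bounded_bilinear[OF V bounded_bilinear_qmat_mult] Ck_on_matrix_inv[OF V]
        Ck_on_add[OF V] Ck_on_ident)
      (simp add: V_def)
  have "inv_into U \<phi> X = \<psi> X" if "X \<in> V" for X
    using bij psi_U[OF that] phi_psi[OF that] by (metis bij_betw_def inv_into_f_f)
  then have "Ck_on n (inv_into U \<phi>) V" for n
    by (intro Ck_on_cong[OF V _ smooth_psi]) simp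
  with bij smooth_phi show "diffeomorphism_on U V \<phi>"
    by (simp add: diffeomorphism_on_def smooth_on_def)
  show "subspace lie_SLHplus" "dim lie_SLHplus = 10"
    by (rule subspace_lie_SLHplus dim_lie_SLHplus)+
  have iff: "\<phi> A \<in> lie_SLHplus \<longleftrightarrow> A \<in> SLHplus" if "A \<in> U" for A
  proof -
    have inv: "invertible (p + A)" using that by (simp add: U_def)
    \<comment> \<open>Left translation by \<open>p\<close> preserves \<open>G\<close>, so the claim at \<open>p\<close> follows from the one at \<open>1\<close>.\<close>
    let ?B = "matrix_inv p ** A"
    have pB: "p ** ?B = A"
      by (simp only: matrix_mul_assoc matrix_inv_qmat[OF inv_p] matrix_mul_lid)
    have "p ** (mat 1 + ?B) = p + A"
      by (simp only: qmat_mult_algebra(2) pB matrix_mul_rid)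
    then have "(mat 1 + \<phi> A) ** (mat 1 + ?B) = 2 *\<^sub>R mat 1"
      unfolding phi_plus qmat_mult_algebra(5)
      by (simp only: matrix_mul_assoc[symmetric] matrix_inv_qmat[OF inv])
    then have "\<phi> A \<in> lie_SLHplus \<longleftrightarrow> ?B \<in> SLHplus"
      by (rule Cayley_SLHplus_iff)
    also have "\<dots> \<longleftrightarrow> A \<in> SLHplus"
      using SLHplus_mult[OF p, of ?B] SLHplus_mult[OF SLHplus_inv[OF p], of A] by (auto simp only: pB)
    finally show ?thesis .
  qed
  show "\<phi> ` (U \<inter> SLHplus) = V \<inter> lie_SLHplus"
  proof (intro equalityI subsetI)
    fix X assume X: "X \<in> V \<inter> lie_SLHplus"
    then have "\<psi> X \<in> U \<inter> SLHplus"
      using iff[of "\<psi> X"] phi_psi[of X] psi_U[of X] by simp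
    with X show "X \<in> \<phi> ` (U \<inter> SLHplus)"
      by (metis Int_iff imageI phi_psi)
  qed (use iff phi_V in auto)
qed

section \<open>Moebius transformations in homogeneous coordinates\<close>

definition hom_coords :: "quat option \<Rightarrow> quat^2" where
  "hom_coords z = (case z of Some q \<Rightarrow> vector [q, 1] | None \<Rightarrow> vector [1, 0])"

definition proj_point :: "quat^2 \<Rightarrow> quat option" where
  "proj_point v = (if v $ 2 = 0 then None else Some (v $ 1 * inverse (v $ 2)))"

lemma moebius_map_eq_proj: "moebius_map A z = proj_point (A *v hom_coords z)"
  by (cases z) (simp_all add: moebius_map_def proj_point_def hom_coords_def Let_def
      matrix_vector_mult_def sum_2)

lemma proj_point_hom_coords: "proj_point (hom_coords z) = z"
  by (cases z) (simp_all add: proj_point_def hom_coords_def)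

lemma hom_coords_nonzero: "hom_coords z \<noteq> 0"
  by (cases z) (auto simp: hom_coords_def vec_eq_iff forall_2)

text \<open>
  A nonzero vector and the normalised coordinates of its point differ by a nonzero scalar on the
  right, the side that commutes with matrices acting from the left.
\<close>

lemma hom_coords_proj_point:
  assumes "v \<noteq> 0"
  obtains r where "r \<noteq> 0" "v = (\<chi> i. hom_coords (proj_point v) $ i * r)"
proof (cases "v $ 2 = 0")
  case True
  with assms have "v $ 1 \<noteq> 0" by (auto simp: vec_eq_iff forall_2)
  with True show ?thesis
    by (intro that[of "v $ 1"]) (simp_all add: proj_point_def hom_coords_def vec_eq_iff forall_2)
next
  case False
  then show ?thesis
    by (intro that[of "v $ 2"])
      (simp_all add: proj_point_def hom_coords_def vec_eq_iff forall_2 mult.assoc)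
qed

lemma proj_point_mult_right:
  assumes "r \<noteq> 0"
  shows "proj_point (\<chi> i. v $ i * r) = proj_point v"
proof -
  have "v $ 1 * r * inverse (v $ 2 * r) = v $ 1 * (r * inverse r) * inverse (v $ 2)" if "v $ 2 \<noteq> 0"
    by (simp only: nonzero_inverse_mult_distrib[OF that assms] mult.assoc)
  with assms show ?thesis by (simp add: proj_point_def)
qed

lemma moebius_map_proj_point:
  assumes "v \<noteq> 0"
  shows "moebius_map A (proj_point v) = proj_point (A *v v)"
proof -
  obtain r where r: "r \<noteq> 0" and v: "v = (\<chi> i. hom_coords (proj_point v) $ i * r)"
    using hom_coords_proj_point[OF assms] .
  have "A *v v = (\<chi> i. (A *v hom_coords (proj_point v)) $ i * r)"
    by (subst v) (simp add: matrix_vector_mult_def vec_eq_iff sum_distrib_right mult.assoc)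
  then show ?thesis
    by (simp add: moebius_map_eq_proj proj_point_mult_right[OF r])
qed

lemma invertible_mult_vec_nonzero:
  fixes A :: qmat
  assumes "invertible A" "v \<noteq> 0"
  shows "A *v v \<noteq> 0"
proof
  assume "A *v v = 0"
  then have "matrix_inv A *v (A *v v) = 0"
    by (simp add: matrix_vector_mult_def vec_eq_iff)
  then have "(matrix_inv A ** A) *v v = 0"
    by (simp only: matrix_vector_mul_assoc)
  with assms show False by (simp add: matrix_inv_qmat)
qed

lemma moebius_map_mult:
  assumes "invertible B"
  shows "moebius_map (A ** B) = moebius_map A \<circ> moebius_map B"
proof
  fix z
  have "moebius_map A (moebius_map B z) = proj_point (A *v (B *v hom_coords z))"
    unfolding moebius_map_eq_proj[of B]
    by (intro moebius_map_proj_point invertible_mult_vec_nonzero assms hom_coords_nonzero)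
  then show "moebius_map (A ** B) z = (moebius_map A \<circ> moebius_map B) z"
    by (simp add: moebius_map_eq_proj[of "A ** B"] matrix_vector_mul_assoc)
qed

lemma moebius_map_one: "moebius_map (mat 1) = id"
  by (simp add: fun_eq_iff moebius_map_eq_proj proj_point_hom_coords)

lemma MHplus_iff: "f \<in> MHplus \<longleftrightarrow>
    (\<exists>A. invertible A \<and> f = moebius_map A \<and> f ` (Some ` Hplus) = Some ` Hplus)"
  by (auto simp: MHplus_def Bex_def GL2H_iff)

lemma group_MHplus: "group MHplus_group"
proof (rule groupI)
  fix f g assume "f \<in> carrier MHplus_group" "g \<in> carrier MHplus_group"
  then obtain A B where A: "invertible A" "f = moebius_map A" "f ` (Some ` Hplus) = Some ` Hplus"
    and B: "invertible B" "g = moebius_map B" "g ` (Some ` Hplus) = Some ` Hplus"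
    by (auto simp: MHplus_group_def MHplus_iff)
  have "f \<circ> g = moebius_map (A ** B)"
    by (simp only: A(2) B(2) moebius_map_mult[OF B(1)])
  moreover have "(f \<circ> g) ` (Some ` Hplus) = Some ` Hplus"
    by (simp only: image_comp[symmetric] A(3) B(3))
  ultimately show "f \<otimes>\<^bsub>MHplus_group\<^esub> g \<in> carrier MHplus_group"
    using invertible_qmat_mult[OF A(1) B(1)]
    by (auto simp: MHplus_group_def MHplus_iff)
next
  show "\<one>\<^bsub>MHplus_group\<^esub> \<in> carrier MHplus_group"
    by (auto simp: MHplus_group_def MHplus_iff invertible_qmat_iff moebius_map_one intro!: exI[of _ "mat 1"])
next
  fix f assume "f \<in> carrier MHplus_group"
  then obtain A where A: "invertible A" "f = moebius_map A" and im: "f ` (Some ` Hplus) = Some ` Hplus"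
    by (auto simp: MHplus_group_def MHplus_iff)
  let ?g = "moebius_map (matrix_inv A)"
  have gf: "?g \<circ> f = id"
    using moebius_map_mult[OF A(1), of "matrix_inv A"] A
    by (simp add: matrix_inv_qmat moebius_map_one)
  have "?g ` (Some ` Hplus) = (?g \<circ> f) ` (Some ` Hplus)"
    by (simp only: im image_comp[symmetric])
  with gf have "?g \<in> carrier MHplus_group"
    using invertible_matrix_inv_qmat[OF A(1)]
    by (auto simp: MHplus_group_def MHplus_iff)
  with gf show "\<exists>g\<in>carrier MHplus_group. g \<otimes>\<^bsub>MHplus_group\<^esub> f = \<one>\<^bsub>MHplus_group\<^esub>"
    by (auto simp: MHplus_group_def)
qed (auto simp: MHplus_group_def comp_assoc)

text \<open>
  With \<open>x = a q + b\<close> and \<open>y = c q + d\<close>, the real part of \<open>x y\<inverse>\<close> has the sign of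
  \<open>Re (x y\<^sup>*)\<close>. The relations between the entries turn the latter into exactly \<open>Re q\<close>, which also
  shows \<open>y \<noteq> 0\<close>.
\<close>

lemma moebius_map_Hplus:
  assumes "A \<in> SLHplus"
  shows "moebius_map A ` (Some ` Hplus) \<subseteq> Some ` Hplus"
proof -
  obtain a b c d where A: "A = mat2 a b c d" by (rule mat2_cases)
  have ac: "qRe (a * qcnj c) = 0" and bd: "qRe (b * qcnj d) = 0" and
    one: "qcnj b * c + qcnj d * a = 1"
    using assms by (simp_all add: A mat2_in_SLHplus_iff)
  have "\<exists>w\<in>Hplus. moebius_map A (Some q) = Some w" if "q \<in> Hplus" for q
  proof -
    define x y where "x = a * q + b" and "y = c * q + d"
    have "x * qcnj y = a * (q * qcnj q) * qcnj c + (a * q) * qcnj d + b * (qcnj q * qcnj c) + b * qcnj d"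
      by (simp add: x_def y_def qcnj_mult distrib_left distrib_right mult.assoc)
    moreover have "qRe (a * (q * qcnj q) * qcnj c) = 0"
      using ac by (simp add: quat_mult_qcnj)
    moreover have "qRe ((a * q) * qcnj d) = qRe (qcnj d * a * q)"
      using qRe_mult_commute[of "a * q" "qcnj d"] by (simp only: mult.assoc)
    moreover have "qRe (b * (qcnj q * qcnj c)) = qRe (qcnj b * c * q)"
      using qRe_qcnj_mult[of b "c * q"] by (simp only: qcnj_mult mult.assoc)
    moreover have "qRe (qcnj d * a * q) + qRe (qcnj b * c * q) = qRe ((qcnj b * c + qcnj d * a) * q)"
      by (simp add: distrib_right)
    ultimately have re: "qRe (x * qcnj y) = qRe q"
      using bd one by simp
    have q: "qRe q > 0" using that by (simp add: Hplus_def)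
    with re have y: "y \<noteq> 0" by auto
    have "qRe (x * inverse y) = inverse ((norm y)\<^sup>2) * qRe q"
      using re by (simp add: inverse_eq_qcnj)
    with q y have "x * inverse y \<in> Hplus" by (simp add: Hplus_def)
    moreover have "moebius_map A (Some q) = Some (x * inverse y)"
      using y by (simp add: moebius_map_def A x_def y_def)
    ultimately show ?thesis by blast
  qed
  then show ?thesis by fastforce
qed

text \<open>
  The image is all of the half space because \<open>A\<inverse>\<close> maps the half space into itself, too.
\<close>

lemma moebius_map_in_MHplus:
  assumes "A \<in> SLHplus"
  shows "moebius_map A \<in> MHplus"
proof -
  let ?H = "Some ` Hplus"
  have inv: "invertible A" by (rule SLHplus_invertible[OF assms])
  have "moebius_map A \<circ> moebius_map (matrix_inv A) = id"
    using moebius_map_mult[OF invertible_matrix_inv_qmat[OF inv], of A]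
    by (simp only: matrix_inv_qmat[OF inv] moebius_map_one)
  then have "?H = (moebius_map A \<circ> moebius_map (matrix_inv A)) ` ?H"
    by (simp only: image_id id_apply)
  also have "\<dots> = moebius_map A ` (moebius_map (matrix_inv A) ` ?H)"
    by (rule image_comp[symmetric])
  also have "\<dots> \<subseteq> moebius_map A ` ?H"
    by (intro image_mono moebius_map_Hplus SLHplus_inv assms)
  finally show ?thesis
    using moebius_map_Hplus[OF assms] inv by (auto simp: MHplus_iff)
qed

lemma group_hom_moebius_map: "group_hom SLHplus_group MHplus_group moebius_map"
proof (rule group_hom.intro[OF group_SLHplus group_MHplus], unfold_locales)
  show "moebius_map \<in> hom SLHplus_group MHplus_group"
    by (auto simp: hom_def SLHplus_group_def SL2H_group_def MHplus_group_def moebius_map_in_MHplus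
        moebius_map_mult SLHplus_invertible)
qed

section \<open>Kernel and centre\<close>

lemma quat_commute_ij:
  assumes "a * Quat 0 1 0 0 = Quat 0 1 0 0 * a" "a * Quat 0 0 1 0 = Quat 0 0 1 0 * a"
  shows "a = qRe a *\<^sub>R 1"
  using assms by (simp add: quat_eq_iff times_quat.sel)

lemma scalar_in_SLHplus:
  assumes "mat2 a 0 0 a \<in> SLHplus" "a = r *\<^sub>R 1"
  shows "mat2 a 0 0 a \<in> {mat 1, - mat 1}"
proof -
  have "r * r = 1"
    using assms by (simp add: mat2_in_SLHplus_iff quat_eq_iff)
  then have "r = 1 \<or> r = -1"
    by (simp add: square_eq_1_iff)
  with assms(2) show ?thesis
    by (auto simp: mat_1_eq_mat2 mat2_algebra)
qed

text \<open>
  Fixing \<open>\<infinity>\<close> and \<open>0\<close> makes the matrix diagonal, and fixing \<open>1\<close> makes it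
  \<open>diag(a, a)\<close>. The remaining condition \<open>a q a\<inverse> = q\<close> says that \<open>a\<close> is central in
  \<open>\<H>\<close>, hence real.
\<close>

lemma kernel_moebius_map: "kernel SLHplus_group MHplus_group moebius_map = {mat 1, - mat 1}"
proof (intro equalityI subsetI)
  fix A assume "A \<in> kernel SLHplus_group MHplus_group moebius_map"
  then have A: "A \<in> SLHplus" and id: "\<And>z. moebius_map A z = z"
    by (auto simp: kernel_def SLHplus_group_def MHplus_group_def)
  obtain a b c d where mat: "A = mat2 a b c d" by (rule mat2_cases)
  have c: "c = 0"
    using id[of None] by (simp add: mat moebius_map_def split: if_splits)
  have d: "d \<noteq> 0" and b: "b = 0"
    using id[of "Some 0"] by (auto simp: mat moebius_map_def c split: if_splits)
  have fix_q: "a * q = q * d" for q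
  proof -
    have "a * q * inverse d = q"
      using id[of "Some q"] d by (simp add: mat moebius_map_def b c)
    then have "q * d = a * q * (inverse d * d)"
      by (simp only: mult.assoc[symmetric])
    with d show ?thesis by simp
  qed
  from fix_q[of 1] have ad: "a = d" by simp
  have eq: "A = mat2 a 0 0 a"
    by (simp only: mat b c ad)
  have "a = qRe a *\<^sub>R 1"
    using fix_q unfolding ad by (intro quat_commute_ij)
  from scalar_in_SLHplus[OF A[unfolded eq] this] show "A \<in> {mat 1, - mat 1}"
    by (simp only: eq)
next
  fix A assume A: "A \<in> {mat 1, - mat 1 :: qmat}"
  then have "moebius_map A = id"
    by (auto simp: mat_1_eq_mat2 mat2_algebra moebius_map_def Let_def fun_eq_iff split: option.split)
  moreover have "A \<in> SLHplus"
    using A by (auto simp: mat_1_eq_mat2 mat2_algebra mat2_in_SLHplus_iff)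
  ultimately show "A \<in> kernel SLHplus_group MHplus_group moebius_map"
    by (simp add: kernel_def SLHplus_group_def MHplus_group_def SL2H_group_def)
qed

text \<open>
  The test elements are \<open>diag(2, 1/2)\<close>, which forces a diagonal matrix, then \<open>K\<close>, which makes the
  two entries equal, and \<open>diag(u, u)\<close> for the units \<open>u = i, j\<close>, which makes the common entry real.
\<close>

lemma center_SLHplus: "group_center SLHplus_group = {mat 1, - mat 1}"
proof (intro equalityI subsetI)
  fix A assume "A \<in> group_center SLHplus_group"
  then have A: "A \<in> SLHplus" and comm: "\<And>X. X \<in> SLHplus \<Longrightarrow> A ** X = X ** A"
    by (auto simp: group_center_def SLHplus_group_def SL2H_group_def)
  obtain a b c d where mat: "A = mat2 a b c d" by (rule mat2_cases)
  have "mat2 (2 *\<^sub>R 1) 0 0 ((1 / 2) *\<^sub>R 1) \<in> SLHplus"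
    by (simp add: mat2_in_SLHplus_iff)
  from comm[OF this] have b: "b = 0" and c: "c = 0"
    by (auto simp: mat mat2_mult quat_eq_iff)
  have "Kmat \<in> SLHplus"
    by (simp add: Kmat_def mat2_in_SLHplus_iff)
  from arg_cong[OF comm[OF this], of "\<lambda>X. X $ 1 $ 2"] have ad: "a = d"
    by (simp add: mat Kmat_def mat2_mult)
  have u: "a * u = u * a" if "qcnj u * u = 1" for u
  proof -
    have "mat2 u 0 0 u \<in> SLHplus"
      using that by (simp add: mat2_in_SLHplus_iff)
    from comm[OF this] show ?thesis by (simp add: mat mat2_mult)
  qed
  have eq: "A = mat2 a 0 0 a"
    by (simp only: mat b c ad)
  have "a = qRe a *\<^sub>R 1"
    by (rule quat_commute_ij; rule u) (simp_all add: quat_eq_iff times_quat.sel)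
  from scalar_in_SLHplus[OF A[unfolded eq] this] show "A \<in> {mat 1, - mat 1}"
    by (simp only: eq)
next
  fix A assume A: "A \<in> {mat 1, - mat 1 :: qmat}"
  have "- mat 1 = (- 1) *\<^sub>R (mat 1 :: qmat)" by simp
  with A have "A ** X = X ** A" for X
    by (auto simp only: insert_iff empty_iff qmat_mult_algebra(5,6) matrix_mul_lid matrix_mul_rid)
  moreover have "A \<in> SLHplus"
    using A by (auto simp: mat_1_eq_mat2 mat2_algebra mat2_in_SLHplus_iff)
  ultimately show "A \<in> group_center SLHplus_group"
    by (simp add: group_center_def SLHplus_group_def SL2H_group_def)
qed

theorem theorem1p12:
  shows
    "group SL2H_group \<and> subgroup SLHplus SL2H_group \<and>
     smooth_submanifold 10 SLHplus \<and>
     SLHplus = {mat2 a b c d | a b c d :: quat.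
        qRe (a * qcnj c) = 0 \<and> qRe (b * qcnj d) = 0 \<and> qcnj b * c + qcnj d * a = 1} \<and>
     group_hom SLHplus_group MHplus_group moebius_map \<and>
     kernel SLHplus_group MHplus_group moebius_map = group_center SLHplus_group \<and>
     group_center SLHplus_group = {mat 1, - mat 1}"
  using group_SL2H subgroup_SLHplus smooth_submanifold_SLHplus SLHplus_eq group_hom_moebius_map
    kernel_moebius_map center_SLHplus
  by simp

end
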